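(* Let $k$ be a constant and $f:(\{0,1\}^n)^k\to\{0,1\}$ a Boolean function. Set $d_i:=D(f^{\{i\},[k]\setminus\{i\}})$ for $i\in[k]$, and assume the Log-Rank Conjecture for $k$-party computation holds with a constant $c'>0$, i.e. for every $n$ and every $g:(\{0,1\}^n)^k\to\{0,1\}$ we have $D(g)=O\big((\log\operatorname{rank}(M_g))^{c'}\big)$. Then $D(f)=O\big((\sum_{i=1}^{k-1}d_i)^{c'}\big)$.
   Context: $D(g)$ for a $k$-argument Boolean function $g$ is its deterministic communication complexity in the "number in hand" model: player $P_\ell$ holds $x_\ell\in\{0,1\}^n$, the players communicate over a broadcast channel, and $D(g)$ is the worst-case number of bits sent by the best deterministic protocol computing $g$; for two-argument functions it is the usual two-party complexity. $M_g$ is the $k$-dimensional array with entries $M_g[x_1,\dots,x_k]=g(x_1,\dots,x_k)$ and $\operatorname{rank}(M_g)$ is its tensor rank over the reals. For a partition $\{I,J\}$ of $[k]$, $f^{I,J}$ is the two-argument function $f^{I,J}(\{x_i\}_{i\in I},\{x_i\}_{i\in J})=f(x_1,\dots,x_k)$. *)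

theory Defs
  imports Complex_Main "HOL-Library.FuncSet"
begin

text \<open>
  Inputs are families \<open>x\<close> indexed by the players; a function \<open>g\<close> of several arguments is only ever
  evaluated on \<open>x \<in> Pi\<^sub>E I X\<close>, where \<open>I\<close> is the set of players and \<open>X l\<close> is the set of possible
  inputs of player \<open>l\<close>. The values of \<open>g\<close> elsewhere are irrelevant.
\<close>

definition strings :: "nat \<Rightarrow> bool list set" where
  "strings n = {w. length w = n}"


subsection \<open>Deterministic protocols with a broadcast channel\<close>

text \<open>
  A position in the tree is the transcript so far. At \<open>Send l h P Q\<close> player \<open>l\<close> broadcasts the bit
  \<open>h (x l)\<close>, which depends on that player's own input (and on the transcript) only; the protocol
  continues with \<open>P\<close> if the bit is 1 and with \<open>Q\<close> otherwise. The output is determined by the full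
  transcript.
\<close>

datatype 'a protocol =
    Output bool
  | Send nat "'a \<Rightarrow> bool" "'a protocol" "'a protocol"

primrec speakers :: "'a protocol \<Rightarrow> nat set" where
  "speakers (Output b) = {}"
| "speakers (Send l h P Q) = insert l (speakers P \<union> speakers Q)"

primrec outcome :: "'a protocol \<Rightarrow> (nat \<Rightarrow> 'a) \<Rightarrow> bool" where
  "outcome (Output b) x = b"
| "outcome (Send l h P Q) x = (if h (x l) then outcome P x else outcome Q x)"

primrec bits_sent :: "'a protocol \<Rightarrow> (nat \<Rightarrow> 'a) \<Rightarrow> nat" where
  "bits_sent (Output b) x = 0"
| "bits_sent (Send l h P Q) x = Suc (if h (x l) then bits_sent P x else bits_sent Q x)"

definition computes ::
  "nat set \<Rightarrow> (nat \<Rightarrow> 'a set) \<Rightarrow> 'a protocol \<Rightarrow> ((nat \<Rightarrow> 'a) \<Rightarrow> bool) \<Rightarrow> bool" where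
  "computes I X P g \<longleftrightarrow> speakers P \<subseteq> I \<and> (\<forall>x \<in> Pi\<^sub>E I X. outcome P x = g x)"

text \<open>
  For finite \<open>I\<close> and finite input sets some protocol computes \<open>g\<close>, so the minimum exists.
\<close>

definition comm_complexity ::
  "nat set \<Rightarrow> (nat \<Rightarrow> 'a set) \<Rightarrow> ((nat \<Rightarrow> 'a) \<Rightarrow> bool) \<Rightarrow> nat" where
  "comm_complexity I X g =
     (LEAST c. \<exists>P. computes I X P g \<and> (\<forall>x \<in> Pi\<^sub>E I X. bits_sent P x \<le> c))"

definition D :: "nat \<Rightarrow> nat \<Rightarrow> ((nat \<Rightarrow> bool list) \<Rightarrow> bool) \<Rightarrow> nat" where
  "D k n g = comm_complexity {1..k} (\<lambda>_. strings n) g"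


subsection \<open>Two-argument functions induced by a partition\<close>

text \<open>
  The two players are 1 and 2; they hold the families \<open>y 1 = {x\<^sub>i}\<^bsub>i \<in> I\<^esub>\<close> and
  \<open>y 2 = {x\<^sub>i}\<^bsub>i \<in> J\<^esub>\<close>, so the input type of each player is \<open>nat \<Rightarrow> bool list\<close>.
\<close>

definition two_arg ::
  "((nat \<Rightarrow> bool list) \<Rightarrow> bool) \<Rightarrow> nat set \<Rightarrow> nat set \<Rightarrow> (nat \<Rightarrow> (nat \<Rightarrow> bool list)) \<Rightarrow> bool" where
  "two_arg f I J y =
     f (\<lambda>i. if i \<in> I then y 1 i else if i \<in> J then y 2 i else undefined)"

definition D_two ::
  "nat \<Rightarrow> nat set \<Rightarrow> nat set \<Rightarrow> ((nat \<Rightarrow> bool list) \<Rightarrow> bool) \<Rightarrow> nat" where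
  "D_two n I J f =
     comm_complexity {1, 2} (\<lambda>l. (if l = 1 then I else J) \<rightarrow>\<^sub>E strings n) (two_arg f I J)"


subsection \<open>Tensor rank over the reals and the Log-Rank Conjecture\<close>

definition tensor_rank :: "nat set \<Rightarrow> (nat \<Rightarrow> 'a set) \<Rightarrow> ((nat \<Rightarrow> 'a) \<Rightarrow> real) \<Rightarrow> nat" where
  "tensor_rank I X M =
     (LEAST r. \<exists>v :: nat \<Rightarrow> nat \<Rightarrow> 'a \<Rightarrow> real.
        \<forall>x \<in> Pi\<^sub>E I X. M x = (\<Sum>t<r. \<Prod>i\<in>I. v t i (x i)))"

definition rankM :: "nat \<Rightarrow> nat \<Rightarrow> ((nat \<Rightarrow> bool list) \<Rightarrow> bool) \<Rightarrow> nat" where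
  "rankM k n g = tensor_rank {1..k} (\<lambda>_. strings n) (\<lambda>x. of_bool (g x))"

text \<open>
  The constant of the \<open>O\<close> is uniform in \<open>n\<close> and \<open>g\<close>. Rank at most 1 is left out: there the logarithm
  is 0 (or meaningless), whereas, e.g., the conjunction of the players' first bits has rank 1 and
  positive complexity, so that without this restriction the bound would be false for
  \<open>k \<ge> 2\<close>, whatever the constant.
\<close>

definition log_rank_conjecture :: "nat \<Rightarrow> real \<Rightarrow> bool" where
  "log_rank_conjecture k c \<longleftrightarrow>
     (\<exists>C. \<forall>n g. rankM k n g \<ge> 2 \<longrightarrow>
        real (D k n g) \<le> C * log 2 (real (rankM k n g)) powr c)"

end

theory Submission
  imports Defs
begin

text \<open>
  A protocol for \<open>f\<^bsup>{i},[k]-{i}\<^esup>\<close> with \<open>d\<^sub>i\<close> bits makes the flattening of \<open>M\<^sub>f\<close> along \<open>i\<close> a matrix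
  of rank at most \<open>2^d\<^sub>i\<close>, so that all of its rows are combinations of \<open>2^d\<^sub>i\<close> of them. Expanding \<open>M\<^sub>f\<close>
  in this way along \<open>i = 1, \<dots>, k - 1\<close> leaves slices that depend on \<open>x\<^sub>k\<close> only, so the
  tensor rank is at most \<open>2\<close> to the power \<open>d\<^sub>1 + \<dots> + d\<^bsub>k-1\<^esub>\<close> and the conjecture applies. If the
  rank is at most 1, the conjecture says nothing; but then \<open>f\<close> is a conjunction of predicates of the
  single inputs and \<open>D f \<le> k\<close>, which suffices since \<open>d\<^sub>1 = 0\<close> only for constant \<open>f\<close>.
\<close>

section \<open>Splitting and reindexing finite sums\<close>

lemma sum_lessThan_add:
  fixes f :: "nat \<Rightarrow> 'b::comm_monoid_add"
  shows "(\<Sum>t<m + n. f t) = (\<Sum>t<m. f t) + (\<Sum>t<n. f (m + t))"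
  by (induction n) (simp_all add: add.assoc)

text \<open>The index \<open>j\<close> encodes the pair \<open>(j div r, j mod r)\<close>. Iterated
  expansions thus become one sum over an initial segment, the form used in
  \<open>tensor_rank\<close>.\<close>

lemma sum_lessThan_mult:
  fixes g :: "nat \<Rightarrow> nat \<Rightarrow> 'b::comm_monoid_add"
  shows "(\<Sum>j<m * r. g (j div r) (j mod r)) = (\<Sum>a<m. \<Sum>b<r. g a b)"
proof (cases "r = 0")
  case False
  show ?thesis
  proof (induction m)
    case (Suc m)
    have "(\<Sum>j<Suc m * r. g (j div r) (j mod r))
        = (\<Sum>j<m * r + r. g (j div r) (j mod r))"
      by (simp add: add.commute)
    also have "\<dots> = (\<Sum>a<m. \<Sum>b<r. g a b) + (\<Sum>b<r. g ((m * r + b) div r) ((m * r + b) mod r))"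
      by (simp only: sum_lessThan_add Suc.IH)
    also have "(\<Sum>b<r. g ((m * r + b) div r) ((m * r + b) mod r)) = (\<Sum>b<r. g m b)"
      using False by (intro sum.cong) auto
    finally show ?case by simp
  qed simp
qed simp


subsection \<open>Communication complexity\<close>

lemma comm_complexity_le:
  assumes "computes I X P g" and "\<And>x. x \<in> Pi\<^sub>E I X \<Longrightarrow> bits_sent P x \<le> c"
  shows "comm_complexity I X g \<le> c"
  unfolding comm_complexity_def using assms by (intro Least_le) blast

lemma bits_sent_bounded: "\<exists>c. \<forall>x. bits_sent P x \<le> c"
proof (induction P)
  case (Send l h P Q)
  then obtain c c' where "\<And>x. bits_sent P x \<le> c" "\<And>x. bits_sent Q x \<le> c'" by blast
  then have "bits_sent (Send l h P Q) x \<le> Suc (max c c')" for x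
    by (auto intro: le_max_iff_disj[THEN iffD2])
  then show ?case by blast
qed auto

lemma outcome_cong: "(\<And>l. l \<in> speakers P \<Longrightarrow> x l = y l) \<Longrightarrow> outcome P x = outcome P y"
  by (induction P) auto

text \<open>Induction on the set of players: \<open>l\<close> tells, for one candidate
  \<open>a\<close> after another, whether it is the input; after a yes the others run a protocol for
  \<open>g\<close> with that input fixed.\<close>

lemma ex_computes:
  assumes "finite I" and "\<And>i. i \<in> I \<Longrightarrow> finite (X i)"
  shows "\<exists>P. computes I X P g"
  using assms
proof (induction I arbitrary: g rule: finite_induct)
  case empty
  have "computes {} X (Output (g (\<lambda>_. undefined))) g" by (simp add: computes_def)
  then show ?case by blast
next
  case (insert l I)
  note IH = insert.IH and fin = insert.prems
  have "\<exists>P. speakers P \<subseteq> insert l I \<and> (\<forall>x \<in> Pi\<^sub>E (insert l I) X. x l \<in> A \<longrightarrow> outcome P x = g x)"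
    if "finite A" for A
    using that
  proof (induction A rule: finite_induct)
    case empty
    show ?case by (rule exI[of _ "Output False"]) simp
  next
    case (insert a A)
    then obtain Q where Q: "speakers Q \<subseteq> insert l I"
      "\<And>x. x \<in> Pi\<^sub>E (insert l I) X \<Longrightarrow> x l \<in> A \<Longrightarrow> outcome Q x = g x" by blast
    obtain P where P: "computes I X P (\<lambda>x. g (x(l := a)))"
      using IH fin by blast
    have "outcome P x = g x" if x: "x \<in> Pi\<^sub>E (insert l I) X" "x l = a" for x
    proof -
      \<comment> \<open>\<open>P\<close> is known to be correct only on families that are
        \<open>undefined\<close> at \<open>l\<close>; as \<open>l\<close> does not speak in
        \<open>P\<close>, resetting that value leaves the outcome unchanged.\<close>
      have "outcome P x = outcome P (x(l := undefined))"
        using P \<open>l \<notin> I\<close> by (intro outcome_cong) (auto simp: computes_def)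
      also have "\<dots> = g x"
        using P x \<open>l \<notin> I\<close> by (auto simp: computes_def PiE_iff extensional_def fun_upd_idem)
      finally show ?thesis .
    qed
    then show ?case
      using P Q by (intro exI[of _ "Send l (\<lambda>z. z = a) P Q"]) (auto simp: computes_def)
  qed
  from this[of "X l"] show ?case
    using insert.prems by (auto simp: computes_def PiE_iff)
qed

text \<open>The minimum exists because some protocol computes \<open>g\<close> and, being a finite
  tree, sends a bounded number of bits.\<close>

lemma comm_complexity_attained:
  assumes "finite I" and "\<And>i. i \<in> I \<Longrightarrow> finite (X i)"
  obtains P where "computes I X P g"
    and "\<And>x. x \<in> Pi\<^sub>E I X \<Longrightarrow> bits_sent P x \<le> comm_complexity I X g"
proof -
  obtain P where "computes I X P g" using ex_computes assms by blast
  moreover obtain c where "\<forall>x. bits_sent P x \<le> c" using bits_sent_bounded by blast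
  ultimately have "\<exists>c P. computes I X P g \<and> (\<forall>x \<in> Pi\<^sub>E I X. bits_sent P x \<le> c)" by blast
  from LeastI_ex[OF this] show thesis
    using that unfolding comm_complexity_def by blast
qed

lemma comm_complexity_const:
  assumes "\<And>x. x \<in> Pi\<^sub>E I X \<Longrightarrow> g x = b"
  shows "comm_complexity I X g = 0"
proof -
  have "comm_complexity I X g \<le> 0"
    using assms by (intro comm_complexity_le[where P = "Output b"]) (simp_all add: computes_def)
  then show ?thesis by simp
qed

text \<open>A \<open>Send\<close> at the root costs a bit on every input, so an optimal protocol is
  a bare \<open>Output\<close> unless there are no inputs at all.\<close>

lemma comm_complexity_eq_0D:
  assumes "finite I" and "\<And>i. i \<in> I \<Longrightarrow> finite (X i)" and "comm_complexity I X g = 0"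
  shows "\<exists>b. \<forall>x \<in> Pi\<^sub>E I X. g x = b"
proof -
  obtain P where "computes I X P g" "\<And>x. x \<in> Pi\<^sub>E I X \<Longrightarrow> bits_sent P x \<le> 0"
    by (rule comm_complexity_attained[of I X g]) (use assms in auto)
  then show ?thesis by (cases P) (auto simp: computes_def)
qed

text \<open>The players announce \<open>h i (x i)\<close> in turn, and the first negative answer
  ends the run with \<open>False\<close>.\<close>

lemma comm_complexity_conj_le:
  assumes "finite I" and g: "\<And>x. x \<in> Pi\<^sub>E I X \<Longrightarrow> g x \<longleftrightarrow> (\<forall>i\<in>I. h i (x i))"
  shows "comm_complexity I X g \<le> card I"
proof -
  have "\<exists>P. speakers P \<subseteq> I \<and> (\<forall>x. outcome P x \<longleftrightarrow> (\<forall>i\<in>I. h i (x i))) \<and> (\<forall>x. bits_sent P x \<le> card I)"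
    using \<open>finite I\<close>
  proof (induction I rule: finite_induct)
    case empty
    show ?case by (rule exI[of _ "Output True"]) simp
  next
    case (insert i I)
    then obtain P where "speakers P \<subseteq> I" "\<And>x. outcome P x \<longleftrightarrow> (\<forall>i\<in>I. h i (x i))"
      "\<And>x. bits_sent P x \<le> card I" by blast
    then show ?case
      using insert.hyps by (intro exI[of _ "Send i (h i) P (Output False)"]) auto
  qed
  then show ?thesis
    using g by (metis comm_complexity_le computes_def)
qed


subsection \<open>Rank\<close>

text \<open>The inputs that reach a leaf form a box, whose indicator is a product of functions of
  single inputs, and at most \<open>2 ^ c\<close> leaves are reached.\<close>

lemma protocol_tensor_decomposition:
  assumes "finite I" "I \<noteq> {}" "speakers P \<subseteq> I"
    and "\<And>x. x \<in> Pi\<^sub>E I X \<Longrightarrow> bits_sent P x \<le> c"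
  shows "\<exists>v :: nat \<Rightarrow> nat \<Rightarrow> 'a \<Rightarrow> real. \<forall>x \<in> Pi\<^sub>E I X.
           of_bool (outcome P x) = (\<Sum>t<2 ^ c. \<Prod>i\<in>I. v t i (x i))"
  using assms(3,4)
proof (induction P arbitrary: X c)
  case (Output b)
  \<comment> \<open>One term suffices for a constant; the padding terms vanish because
    \<open>I\<close> is nonempty, an empty product being 1.\<close>
  have "of_bool b = (\<Sum>t<(2::nat) ^ c. \<Prod>i\<in>I. of_bool (t = 0 \<and> b) :: real)"
  proof -
    have "(\<Prod>i\<in>I. of_bool (t = 0 \<and> b) :: real) = (if 0 = t then of_bool b else 0)" for t :: nat
      using assms(1,2) by (auto simp: card_gt_0_iff)
    then show ?thesis by simp
  qed
  then show ?case
    by (intro exI[of _ "\<lambda>t i a. of_bool (t = 0 \<and> b)"]) (simp del: prod_constant)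
next
  case (Send l h P Q)
  show ?case
  proof (cases "Pi\<^sub>E I X = {}")
    case False
    then obtain d where c: "c = Suc d"
      using Send.prems(2) by (cases c) fastforce+
    \<comment> \<open>Restricting the inputs of \<open>l\<close> alone keeps the domain a box, so
      the induction hypotheses apply with one bit less.\<close>
    define X1 where "X1 = X(l := {a \<in> X l. h a})"
    define X2 where "X2 = X(l := {a \<in> X l. \<not> h a})"
    have l: "l \<in> I" using Send.prems by simp
    have X1: "x \<in> Pi\<^sub>E I X1 \<longleftrightarrow> x \<in> Pi\<^sub>E I X \<and> h (x l)" for x
      using l by (auto simp: X1_def PiE_iff split: if_splits)
    have X2: "x \<in> Pi\<^sub>E I X2 \<longleftrightarrow> x \<in> Pi\<^sub>E I X \<and> \<not> h (x l)" for x
      using l by (auto simp: X2_def PiE_iff split: if_splits)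
    have "bits_sent P x \<le> d" if "x \<in> Pi\<^sub>E I X1" for x
      using Send.prems(2)[of x] that by (simp add: X1 c)
    then obtain v :: "nat \<Rightarrow> nat \<Rightarrow> 'a \<Rightarrow> real" where v: "\<And>x. x \<in> Pi\<^sub>E I X1 \<Longrightarrow>
        of_bool (outcome P x) = (\<Sum>t<2 ^ d. \<Prod>i\<in>I. v t i (x i))"
      using Send.IH(1)[of X1 d] Send.prems(1) by auto
    have "bits_sent Q x \<le> d" if "x \<in> Pi\<^sub>E I X2" for x
      using Send.prems(2)[of x] that by (simp add: X2 c)
    then obtain w :: "nat \<Rightarrow> nat \<Rightarrow> 'a \<Rightarrow> real" where w: "\<And>x. x \<in> Pi\<^sub>E I X2 \<Longrightarrow>
        of_bool (outcome Q x) = (\<Sum>t<2 ^ d. \<Prod>i\<in>I. w t i (x i))"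
      using Send.IH(2)[of X2 d] Send.prems(1) by auto
    \<comment> \<open>The first \<open>2 ^ d\<close> terms come from \<open>P\<close>, the others
      from \<open>Q\<close>; a zero factor at \<open>l\<close> switches off the half that does not
      match \<open>h (x l)\<close>.\<close>
    define u where "u t i a = (if t < 2 ^ d then (if i = l \<and> \<not> h a then 0 else v t i a)
        else (if i = l \<and> h a then 0 else w (t - 2 ^ d) i a))" for t i a
    have "of_bool (outcome (Send l h P Q) x) = (\<Sum>t<2 ^ c. \<Prod>i\<in>I. u t i (x i))"
      if x: "x \<in> Pi\<^sub>E I X" for x
    proof -
      have "(\<Sum>t<2 ^ c. \<Prod>i\<in>I. u t i (x i))
          = (\<Sum>t<2 ^ d. \<Prod>i\<in>I. u t i (x i)) + (\<Sum>t<2 ^ d. \<Prod>i\<in>I. u (2 ^ d + t) i (x i))"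
        by (simp add: c mult_2 sum_lessThan_add)
      moreover have "(\<Sum>t<2 ^ d. \<Prod>i\<in>I. u t i (x i)) = (if h (x l) then of_bool (outcome P x) else 0)"
        using x l \<open>finite I\<close> by (auto simp: v X1 u_def intro!: sum.cong sum.neutral prod.cong bexI[of _ l])
      moreover have "(\<Sum>t<2 ^ d. \<Prod>i\<in>I. u (2 ^ d + t) i (x i))
          = (if h (x l) then 0 else of_bool (outcome Q x))"
        using x l \<open>finite I\<close> by (auto simp: w X2 u_def intro!: sum.cong sum.neutral prod.cong bexI[of _ l])
      ultimately show ?thesis by simp
    qed
    then show ?thesis by blast
  qed simp
qed

text \<open>Elimination: subtracting multiples of a row where the last factor is nonzero kills that factor.\<close>

lemma rows_spanned_by_rank_many_rows:
  fixes F :: "'a \<Rightarrow> 'b \<Rightarrow> real" and r :: nat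
  assumes "A \<noteq> {}" and "\<And>x y. x \<in> A \<Longrightarrow> y \<in> B \<Longrightarrow> F x y = (\<Sum>t<r. a t x * b t y)"
  shows "\<exists>(u :: nat \<Rightarrow> 'a \<Rightarrow> real) z. (\<forall>t. z t \<in> A) \<and> (\<forall>x\<in>A. \<forall>y\<in>B. F x y = (\<Sum>t<r. u t x * F (z t) y))"
  using assms(2)
proof (induction r arbitrary: F a)
  case 0
  then show ?case using \<open>A \<noteq> {}\<close> by (auto intro!: exI[of _ "\<lambda>_. SOME x. x \<in> A"] simp: some_in_eq)
next
  case (Suc r)
  show ?case
  proof (cases "\<forall>x\<in>A. a r x = 0")
    case True
    then have "F x y = (\<Sum>t<r. a t x * b t y)" if "x \<in> A" "y \<in> B" for x y
      using Suc.prems[OF that] that by simp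
    from Suc.IH[of F a, OF this] obtain u z where uz: "\<And>t. z t \<in> A"
      "\<And>x y. x \<in> A \<Longrightarrow> y \<in> B \<Longrightarrow> F x y = (\<Sum>t<r. u t x * F (z t) y)"
      by blast
    have "F x y = (\<Sum>t<Suc r. (if t < r then u t x else 0) * F (z t) y)"
      if "x \<in> A" "y \<in> B" for x y
      using uz(2)[OF that] by simp
    with uz(1) show ?thesis
      by (intro exI[of _ "\<lambda>t x. if t < r then u t x else 0"] exI[of _ z] conjI allI ballI)
  next
    case False
    then obtain p where p: "p \<in> A" "a r p \<noteq> 0" by blast
    \<comment> \<open>Row \<open>p\<close> is the pivot: subtracting \<open>q x\<close> times it
      cancels the term with index \<open>r\<close>.\<close>
    define q where "q x = a r x / a r p" for x
    define G where "G x y = F x y - q x * F p y" for x y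
    have "G x y = (\<Sum>t<r. (a t x - q x * a t p) * b t y)" if "x \<in> A" "y \<in> B" for x y
      using Suc.prems[OF that] Suc.prems[OF p(1) that(2)] p(2)
      by (simp add: G_def q_def algebra_simps sum_subtractf sum_distrib_left)
    from Suc.IH[of G "\<lambda>t x. a t x - q x * a t p", OF this] obtain u z where uz: "\<And>t. z t \<in> A"
      "\<And>x y. x \<in> A \<Longrightarrow> y \<in> B \<Longrightarrow> G x y = (\<Sum>t<r. u t x * G (z t) y)"
      by blast
    \<comment> \<open>Rewriting \<open>G\<close> in terms of \<open>F\<close> leaves the
      coefficients of the rows \<open>z t\<close> alone and collects all multiples of the pivot row
      at index \<open>r\<close>.\<close>
    define u' where "u' t x = (if t < r then u t x else q x - (\<Sum>t<r. u t x * q (z t)))" for t x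
    define z' where "z' t = (if t < r then z t else p)" for t
    have F: "F x y = (\<Sum>t<Suc r. u' t x * F (z' t) y)" if "x \<in> A" "y \<in> B" for x y
    proof -
      have "F x y = q x * F p y + (\<Sum>t<r. u t x * G (z t) y)"
        using uz(2)[OF that] by (simp add: G_def)
      also have "\<dots> = (\<Sum>t<Suc r. u' t x * F (z' t) y)"
        by (simp add: G_def u'_def z'_def algebra_simps sum_subtractf sum_distrib_left)
      finally show ?thesis .
    qed
    have "z' t \<in> A" for t using uz(1) p(1) by (simp add: z'_def)
    with F show ?thesis by (intro exI[of _ u'] exI[of _ z'] conjI allI ballI)
  qed
qed

text \<open>Expanding along one coordinate after another moves the dependence on the coordinates in
  \<open>S\<close> into scalar factors, and the numbers of terms multiply.\<close>

lemma slice_expansion: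
  fixes M :: "(nat \<Rightarrow> 'a) \<Rightarrow> real" and r :: "nat \<Rightarrow> nat"
  assumes "finite S" "S \<subseteq> I"
    and z: "\<And>i t. i \<in> S \<Longrightarrow> z i t \<in> X i"
    and M: "\<And>i x. i \<in> S \<Longrightarrow> x \<in> Pi\<^sub>E I X \<Longrightarrow> M x = (\<Sum>t<r i. u i t (x i) * M (x(i := z i t)))"
  shows "\<exists>(v :: nat \<Rightarrow> nat \<Rightarrow> 'a \<Rightarrow> real) w. (\<forall>j. \<forall>i\<in>S. w j i \<in> X i) \<and> (\<forall>x \<in> Pi\<^sub>E I X.
    M x = (\<Sum>j<(\<Prod>i\<in>S. r i). (\<Prod>i\<in>S. v j i (x i)) * M (\<lambda>i. if i \<in> S then w j i else x i)))"
  using assms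
proof (induction S rule: finite_induct)
  case (insert i S)
  have "\<exists>(v :: nat \<Rightarrow> nat \<Rightarrow> 'a \<Rightarrow> real) w. (\<forall>j. \<forall>i\<in>S. w j i \<in> X i) \<and> (\<forall>x \<in> Pi\<^sub>E I X.
    M x = (\<Sum>j<(\<Prod>i\<in>S. r i). (\<Prod>i\<in>S. v j i (x i)) * M (\<lambda>i. if i \<in> S then w j i else x i)))"
    using insert.prems(1) by (intro insert.IH insert.prems(2,3)) auto
  then obtain v :: "nat \<Rightarrow> nat \<Rightarrow> 'a \<Rightarrow> real" and w
    where "\<forall>j. \<forall>i\<in>S. w j i \<in> X i" and "\<forall>x \<in> Pi\<^sub>E I X. M x =
      (\<Sum>j<(\<Prod>i\<in>S. r i). (\<Prod>i\<in>S. v j i (x i)) * M (\<lambda>i. if i \<in> S then w j i else x i))"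
    by (elim exE conjE)
  note w = this(1)[rule_format] and v = this(2)[rule_format]
  define m where "m = (\<Prod>i\<in>S. r i)"
  \<comment> \<open>The quotient of \<open>j\<close> by \<open>r i\<close> indexes the expansion
    along \<open>S\<close>, the remainder the new one along \<open>i\<close>.\<close>
  define v' where "v' j i' = (if i' = i then u i (j mod r i) else v (j div r i) i')" for j i'
  define w' where "w' j i' = (if i' = i then z i (j mod r i) else w (j div r i) i')" for j i'
  have "M x = (\<Sum>j<(\<Prod>i\<in>insert i S. r i). (\<Prod>i\<in>insert i S. v' j i (x i)) *
      M (\<lambda>i'. if i' \<in> insert i S then w' j i' else x i'))" (is "_ = ?R")
    if x: "x \<in> Pi\<^sub>E I X" for x
  proof -
    define y where "y j = (\<lambda>i. if i \<in> S then w j i else x i)" for j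
    \<comment> \<open>The constants in \<open>w\<close> are admissible inputs, so each slice is
      again evaluated inside the domain and can be expanded along \<open>i\<close>.\<close>
    have y: "y j \<in> Pi\<^sub>E I X" for j
      using x w insert.prems(1) by (auto simp: y_def PiE_iff extensional_def)
    have "M x = (\<Sum>j<m. (\<Prod>i\<in>S. v j i (x i)) * M (y j))"
      using v[OF x] by (simp add: m_def y_def)
    also have "\<dots> = (\<Sum>j<m. \<Sum>t<r i. u i t (x i) * (\<Prod>i\<in>S. v j i (x i)) * M ((y j)(i := z i t)))"
    proof (rule sum.cong)
      fix j
      have "y j i = x i" using insert.hyps by (simp add: y_def)
      then have "M (y j) = (\<Sum>t<r i. u i t (x i) * M ((y j)(i := z i t)))"
        using insert.prems(3)[OF insertI1 y, of j] by (simp only:)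
      then show "(\<Prod>i\<in>S. v j i (x i)) * M (y j)
          = (\<Sum>t<r i. u i t (x i) * (\<Prod>i\<in>S. v j i (x i)) * M ((y j)(i := z i t)))"
        by (simp only: sum_distrib_left mult_ac)
    qed simp
    also have "\<dots> = (\<Sum>j<m * r i. u i (j mod r i) (x i) * (\<Prod>i'\<in>S. v (j div r i) i' (x i')) *
        M ((y (j div r i))(i := z i (j mod r i))))"
      by (rule sum_lessThan_mult[symmetric])
    also have "\<dots> = ?R"
    proof (rule sum.cong)
      fix j
      have "(\<Prod>i\<in>insert i S. v' j i (x i)) = u i (j mod r i) (x i) * (\<Prod>i'\<in>S. v (j div r i) i' (x i'))"
        using insert.hyps by (auto simp: v'_def intro!: prod.cong)
      moreover have "(y (j div r i))(i := z i (j mod r i))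
          = (\<lambda>i'. if i' \<in> insert i S then w' j i' else x i')"
        by (auto simp: y_def w'_def)
      ultimately show "u i (j mod r i) (x i) * (\<Prod>i'\<in>S. v (j div r i) i' (x i')) *
        M ((y (j div r i))(i := z i (j mod r i))) = (\<Prod>i\<in>insert i S. v' j i (x i)) *
      M (\<lambda>i'. if i' \<in> insert i S then w' j i' else x i')"
        by simp
    qed (use insert.hyps in \<open>simp add: m_def mult.commute\<close>)
    finally show ?thesis .
  qed
  moreover have "\<forall>j. \<forall>i'\<in>insert i S. w' j i' \<in> X i'"
    using w insert.prems(2) by (auto simp: w'_def)
  ultimately show ?case by blast
qed (auto intro!: exI)

text \<open>After expansion along \<open>S\<close> only coordinate \<open>p\<close> is free, so the
  slice itself serves as the factor at \<open>p\<close>.\<close>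

lemma slice_expansion_tensor_decomposition:
  fixes M :: "(nat \<Rightarrow> 'a) \<Rightarrow> real" and r :: "nat \<Rightarrow> nat"
  assumes "finite S" "p \<notin> S"
    and z: "\<And>i t. i \<in> S \<Longrightarrow> z i t \<in> X i"
    and M: "\<And>i x. i \<in> S \<Longrightarrow> x \<in> Pi\<^sub>E (insert p S) X \<Longrightarrow>
              M x = (\<Sum>t<r i. u i t (x i) * M (x(i := z i t)))"
  shows "\<exists>v :: nat \<Rightarrow> nat \<Rightarrow> 'a \<Rightarrow> real. \<forall>x \<in> Pi\<^sub>E (insert p S) X.
           M x = (\<Sum>j<(\<Prod>i\<in>S. r i). \<Prod>i\<in>insert p S. v j i (x i))"
proof -
  obtain v w where vw: "\<And>x. x \<in> Pi\<^sub>E (insert p S) X \<Longrightarrow> M x =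
      (\<Sum>j<(\<Prod>i\<in>S. r i). (\<Prod>i\<in>S. v j i (x i)) * M (\<lambda>i. if i \<in> S then w j i else x i))"
    using slice_expansion[where I = "insert p S" and S = S and z = z and X = X and M = M
        and r = r and u = u] assms by blast
  \<comment> \<open>Families in the domain are \<open>undefined\<close> outside
    \<open>insert p S\<close>, so the value at \<open>p\<close> determines the argument of
    \<open>M\<close>.\<close>
  define g where "g j a = M (\<lambda>i. if i \<in> S then w j i else if i = p then a else undefined)" for j a
  define v' where "v' j i = (if i = p then g j else v j i)" for j i
  have "M x = (\<Sum>j<(\<Prod>i\<in>S. r i). \<Prod>i\<in>insert p S. v' j i (x i))"
    if x: "x \<in> Pi\<^sub>E (insert p S) X" for x
  proof -
    have "M (\<lambda>i. if i \<in> S then w j i else x i) = g j (x p)" for j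
      using x unfolding g_def
      by (intro arg_cong[where f = M]) (auto simp: PiE_iff extensional_def)
    moreover have "(\<Prod>i\<in>S. v' j i (x i)) = (\<Prod>i\<in>S. v j i (x i))" for j
      using assms(2) by (auto simp: v'_def intro!: prod.cong)
    ultimately show ?thesis
      using assms(1,2) by (simp add: vw[OF x] v'_def mult.commute)
  qed
  then show ?thesis by blast
qed


subsection \<open>The induced two-argument functions\<close>

lemma finite_strings: "finite (strings n)"
  using finite_lists_length_eq[of "UNIV :: bool set" n] by (simp add: strings_def)

lemma strings_nonempty: "strings n \<noteq> {}"
  using Ex_list_of_length by (auto simp: strings_def)

lemma finite_two_arg_inputs:
  "finite I \<Longrightarrow> finite J \<Longrightarrow> finite ((if l = (1::nat) then I else J) \<rightarrow>\<^sub>E strings n)"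
  by (auto intro!: finite_PiE simp: finite_strings)

text \<open>The restrictions of \<open>x\<close> to \<open>{i}\<close> and \<open>I - {i}\<close>
  form a two-party input from which \<open>two_arg\<close> reassembles \<open>x\<close>, so
  constancy passes to \<open>f\<close>.\<close>

lemma D_two_eq_0D:
  assumes "finite I" "i \<in> I" "D_two n {i} (I - {i}) f = 0"
  shows "\<exists>b. \<forall>x \<in> I \<rightarrow>\<^sub>E strings n. f x = b"
proof -
  obtain b where b: "\<And>y. y \<in> Pi\<^sub>E {1, 2} (\<lambda>l. (if l = 1 then {i} else I - {i}) \<rightarrow>\<^sub>E strings n)
      \<Longrightarrow> two_arg f {i} (I - {i}) y = b"
    using comm_complexity_eq_0D[OF _ finite_two_arg_inputs assms(3)[unfolded D_two_def]] assms(1)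
    by auto
  have "f x = b" if x: "x \<in> I \<rightarrow>\<^sub>E strings n" for x
  proof -
    define y where "y = (\<lambda>l::nat. if l = 1 then restrict x {i} else if l = 2 then restrict x (I - {i})
      else undefined)"
    have "two_arg f {i} (I - {i}) y = b"
      using x assms(2) by (intro b) (auto simp: y_def PiE_iff extensional_def split: if_splits)
    moreover have "two_arg f {i} (I - {i}) y = f x"
      using x assms(2) unfolding two_arg_def
      by (intro arg_cong[where f = f]) (auto simp: y_def PiE_iff extensional_def)
    ultimately show ?thesis by simp
  qed
  then show ?thesis by (intro exI[of _ b]) simp
qed

text \<open>An optimal two-party protocol factorises the flattening along \<open>i\<close>;
  elimination then replaces its column functions by actual rows. These are slices of
  \<open>f\<close>, which is what permits further expansion along other coordinates.\<close>

lemma D_two_slice_expansion: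
  assumes "finite I" "i \<in> I"
  shows "\<exists>(u :: nat \<Rightarrow> bool list \<Rightarrow> real) z. (\<forall>t. z t \<in> strings n) \<and> (\<forall>x \<in> I \<rightarrow>\<^sub>E strings n.
           (of_bool (f x) :: real) =
             (\<Sum>t<2 ^ D_two n {i} (I - {i}) f. u t (x i) * of_bool (f (x(i := z t)))))"
proof -
  define d where "d = D_two n {i} (I - {i}) f"
  define Y where "Y = (\<lambda>l::nat. (if l = 1 then {i} else I - {i}) \<rightarrow>\<^sub>E strings n)"
  obtain P where P: "computes {1, 2} Y P (two_arg f {i} (I - {i}))"
    and d: "\<And>y. y \<in> Pi\<^sub>E {1, 2} Y \<Longrightarrow> bits_sent P y \<le> d"
  proof (rule comm_complexity_attained[of "{1, 2}" Y "two_arg f {i} (I - {i})"])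
    show "finite (Y l)" for l using assms(1) unfolding Y_def by (intro finite_two_arg_inputs) auto
  qed (auto simp: d_def D_two_def Y_def)
  obtain v :: "nat \<Rightarrow> nat \<Rightarrow> (nat \<Rightarrow> bool list) \<Rightarrow> real" where v: "\<And>y. y \<in> Pi\<^sub>E {1, 2} Y \<Longrightarrow>
      of_bool (two_arg f {i} (I - {i}) y) = (\<Sum>t<2 ^ d. \<Prod>l\<in>{1, 2}. v t l (y l))"
    using protocol_tensor_decomposition[of "{1, 2}" P Y d] P d unfolding computes_def by auto
  \<comment> \<open>\<open>F\<close> is the flattening: rows are the inputs of player
    \<open>i\<close>, columns the families of all other inputs.\<close>
  define F :: "bool list \<Rightarrow> (nat \<Rightarrow> bool list) \<Rightarrow> real"
    where "F a y = of_bool (f (y(i := a)))" for a y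
  have "F a y = (\<Sum>t<2 ^ d. v t 1 (\<lambda>j. if j = i then a else undefined) * v t 2 y)"
    if a: "a \<in> strings n" and y: "y \<in> (I - {i}) \<rightarrow>\<^sub>E strings n" for a y
  proof -
    define w where "w = (\<lambda>l::nat. if l = 1 then (\<lambda>j. if j = i then a else undefined)
      else if l = 2 then y else undefined)"
    have "w \<in> Pi\<^sub>E {1, 2} Y"
      using a y by (auto simp: w_def Y_def PiE_iff extensional_def split: if_splits)
    moreover have "two_arg f {i} (I - {i}) w = f (y(i := a))"
      using y unfolding two_arg_def
      by (intro arg_cong[where f = f]) (auto simp: w_def PiE_iff extensional_def)
    ultimately show ?thesis
      using v[of w] by (simp add: F_def w_def)
  qed
  then have "\<exists>(u :: nat \<Rightarrow> bool list \<Rightarrow> real) z. (\<forall>t. z t \<in> strings n) \<and>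
      (\<forall>a\<in>strings n. \<forall>y\<in>(I - {i}) \<rightarrow>\<^sub>E strings n. F a y = (\<Sum>t<2 ^ d. u t a * F (z t) y))"
    by (rule rows_spanned_by_rank_many_rows[OF strings_nonempty])
  then obtain u :: "nat \<Rightarrow> bool list \<Rightarrow> real" and z where z: "\<forall>t. z t \<in> strings n"
    and u: "\<forall>a\<in>strings n. \<forall>y\<in>(I - {i}) \<rightarrow>\<^sub>E strings n. F a y = (\<Sum>t<2 ^ d. u t a * F (z t) y)"
    by (elim exE conjE)
  have "of_bool (f x) = (\<Sum>t<2 ^ d. u t (x i) * of_bool (f (x(i := z t))))"
    if x: "x \<in> I \<rightarrow>\<^sub>E strings n" for x
  proof -
    have "x(i := undefined) \<in> (I - {i}) \<rightarrow>\<^sub>E strings n"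
      using x by (auto simp: PiE_iff extensional_def)
    moreover have "x i \<in> strings n" using x assms(2) by auto
    ultimately show ?thesis
      using u[rule_format, of "x i" "x(i := undefined)"] by (simp add: F_def)
  qed
  with z show ?thesis unfolding d_def by (intro exI[of _ u] exI[of _ z] conjI ballI)
qed

section \<open>Tensor rank against the two-party complexities\<close>

lemma tensor_rank_le:
  fixes v :: "nat \<Rightarrow> nat \<Rightarrow> 'a \<Rightarrow> real"
  assumes "\<And>x. x \<in> Pi\<^sub>E I X \<Longrightarrow> M x = (\<Sum>t<r. \<Prod>i\<in>I. v t i (x i))"
  shows "tensor_rank I X M \<le> r"
  unfolding tensor_rank_def using assms by (intro Least_le) blast

text \<open>A decomposition of any length guarantees that the minimum in \<open>tensor_rank\<close>
  exists.\<close>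

lemma tensor_rank_attained:
  fixes v :: "nat \<Rightarrow> nat \<Rightarrow> 'a \<Rightarrow> real"
  assumes "\<And>x. x \<in> Pi\<^sub>E I X \<Longrightarrow> M x = (\<Sum>t<r. \<Prod>i\<in>I. v t i (x i))"
  shows "\<exists>v :: nat \<Rightarrow> nat \<Rightarrow> 'a \<Rightarrow> real.
    \<forall>x \<in> Pi\<^sub>E I X. M x = (\<Sum>t<tensor_rank I X M. \<Prod>i\<in>I. v t i (x i))"
  unfolding tensor_rank_def
  by (rule LeastI[where P = "\<lambda>r. \<exists>v :: nat \<Rightarrow> nat \<Rightarrow> 'a \<Rightarrow> real.
    \<forall>x \<in> Pi\<^sub>E I X. M x = (\<Sum>t<r. \<Prod>i\<in>I. v t i (x i))"]) (use assms in blast)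

text \<open>Player \<open>k\<close> is the coordinate left free, so only the other
  \<open>k - 1\<close> complexities enter; the term counts are powers of 2 and multiply to 2 to the
  power of their sum.\<close>

lemma tensor_decomposition_D_two:
  assumes "k \<ge> 1"
  shows "\<exists>v :: nat \<Rightarrow> nat \<Rightarrow> bool list \<Rightarrow> real. \<forall>x \<in> {1..k} \<rightarrow>\<^sub>E strings n.
    of_bool (f x) = (\<Sum>t<2 ^ (\<Sum>i = 1..k - 1. D_two n {i} ({1..k} - {i}) f).
      \<Prod>i\<in>{1..k}. v t i (x i))"
proof -
  have k: "{1..k} = insert k {1..k - 1}" using assms by auto
  have "\<forall>i\<in>{1..k - 1}. \<exists>(u :: nat \<Rightarrow> bool list \<Rightarrow> real) z. (\<forall>t. z t \<in> strings n) \<and> (\<forall>x \<in> {1..k} \<rightarrow>\<^sub>E strings n.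
      (of_bool (f x) :: real) =
        (\<Sum>t<2 ^ D_two n {i} ({1..k} - {i}) f. u t (x i) * of_bool (f (x(i := z t)))))"
    by (intro ballI D_two_slice_expansion) auto
  from bchoice[OF this] obtain u :: "nat \<Rightarrow> nat \<Rightarrow> bool list \<Rightarrow> real"
    where "\<forall>i\<in>{1..k - 1}. \<exists>z. (\<forall>t. z t \<in> strings n) \<and> (\<forall>x \<in> {1..k} \<rightarrow>\<^sub>E strings n.
      (of_bool (f x) :: real) =
        (\<Sum>t<2 ^ D_two n {i} ({1..k} - {i}) f. u i t (x i) * of_bool (f (x(i := z t)))))" ..
  from bchoice[OF this] obtain z
    where z: "\<forall>i\<in>{1..k - 1}. (\<forall>t. z i t \<in> strings n) \<and> (\<forall>x \<in> {1..k} \<rightarrow>\<^sub>E strings n.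
      (of_bool (f x) :: real) =
        (\<Sum>t<2 ^ D_two n {i} ({1..k} - {i}) f. u i t (x i) * of_bool (f (x(i := z i t)))))" ..
  have "k \<notin> {1..k - 1}" using assms by auto
  from slice_expansion_tensor_decomposition[OF finite_atLeastAtMost this,
      where z = z and X = "\<lambda>_. strings n" and M = "\<lambda>x. of_bool (f x)"
        and r = "\<lambda>i. 2 ^ D_two n {i} ({1..k} - {i}) f" and u = u]
  show ?thesis
    unfolding k[symmetric] power_sum using z by blast
qed

lemma rankM_le_D_two:
  assumes "k \<ge> 1"
  shows "rankM k n f \<le> 2 ^ (\<Sum>i = 1..k - 1. D_two n {i} ({1..k} - {i}) f)"
  using tensor_decomposition_D_two[OF assms, of n f] unfolding rankM_def
  by (auto intro: tensor_rank_le)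

text \<open>Rank 0 makes \<open>f\<close> false throughout. A single product is nonzero exactly when
  all its factors are, which makes \<open>f\<close> a conjunction of predicates of single
  inputs.\<close>

lemma D_le_if_rankM_le_1:
  assumes "k \<ge> 1" "rankM k n f \<le> 1"
  shows "D k n f \<le> k"
proof -
  obtain v0 :: "nat \<Rightarrow> nat \<Rightarrow> bool list \<Rightarrow> real" where
    v0: "\<forall>x \<in> {1..k} \<rightarrow>\<^sub>E strings n. of_bool (f x) =
      (\<Sum>t<2 ^ (\<Sum>i = 1..k - 1. D_two n {i} ({1..k} - {i}) f). \<Prod>i\<in>{1..k}. v0 t i (x i))"
    using tensor_decomposition_D_two[OF assms(1), of n f] ..
  from tensor_rank_attained[OF v0[rule_format]] obtain v :: "nat \<Rightarrow> nat \<Rightarrow> bool list \<Rightarrow> real" where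
    "\<forall>x \<in> {1..k} \<rightarrow>\<^sub>E strings n. of_bool (f x) = (\<Sum>t<rankM k n f. \<Prod>i\<in>{1..k}. v t i (x i))"
    unfolding rankM_def ..
  note v = this[rule_format]
  show ?thesis
  proof (cases "rankM k n f = 0")
    case True
    then have "f x = False" if "x \<in> {1..k} \<rightarrow>\<^sub>E strings n" for x
      using v[OF that] by simp
    then have "D k n f = 0" unfolding D_def by (rule comm_complexity_const)
    then show ?thesis by simp
  next
    case False
    then have r: "rankM k n f = 1" using assms(2) by simp
    have "f x \<longleftrightarrow> (\<forall>i\<in>{1..k}. v 0 i (x i) \<noteq> 0)" if "x \<in> {1..k} \<rightarrow>\<^sub>E strings n" for x
    proof -
      have "of_bool (f x) = (\<Prod>i\<in>{1..k}. v 0 i (x i))" using v[OF that] unfolding r by simp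
      then have "f x \<longleftrightarrow> (\<Prod>i\<in>{1..k}. v 0 i (x i)) \<noteq> 0" by (metis of_bool_eq_0_iff)
      then show ?thesis by (simp add: prod_zero_iff)
    qed
    then show ?thesis
      using comm_complexity_conj_le[of "{1..k}" "\<lambda>_. strings n" f "\<lambda>i a. v 0 i a \<noteq> 0"]
      by (simp add: D_def)
  qed
qed

theorem theorem4:
  fixes k :: nat and c' :: real
  assumes "k \<ge> 2"
    and "c' > 0"
    and "log_rank_conjecture k c'"
  shows "\<exists>C. \<forall>n (f :: (nat \<Rightarrow> bool list) \<Rightarrow> bool).
           real (D k n f) \<le> C * real (\<Sum>i = 1..k - 1. D_two n {i} ({1..k} - {i}) f) powr c'"
proof -
  obtain C where C: "\<And>n g. rankM k n g \<ge> 2 \<Longrightarrow>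
      real (D k n g) \<le> C * log 2 (real (rankM k n g)) powr c'"
    using assms(3) unfolding log_rank_conjecture_def by blast
  \<comment> \<open>\<open>C\<close> serves rank at least 2 and \<open>k\<close> serves rank at most
    1; the maximum is also nonnegative whatever the sign of \<open>C\<close>, as monotonicity of
    multiplication requires.\<close>
  have "real (D k n f) \<le>
      max C (real k) * real (\<Sum>i = 1..k - 1. D_two n {i} ({1..k} - {i}) f) powr c'"
    (is "_ \<le> max C (real k) * real ?s powr c'") for n and f :: "(nat \<Rightarrow> bool list) \<Rightarrow> bool"
  proof (cases "rankM k n f \<ge> 2")
    case True
    have "rankM k n f \<le> 2 ^ ?s" using assms(1) by (intro rankM_le_D_two) simp
    then have "real (rankM k n f) \<le> 2 ^ ?s" by (simp only: of_nat_le_numeral_power_cancel_iff)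
    then have "log 2 (real (rankM k n f)) \<le> log 2 (2 ^ ?s)"
      using True by (intro log_mono) auto
    also have "\<dots> = real ?s" by (simp add: log_nat_power)
    finally have "log 2 (real (rankM k n f)) powr c' \<le> real ?s powr c'"
      using True assms(2) by (intro powr_mono2) auto
    then have "max C (real k) * log 2 (real (rankM k n f)) powr c' \<le> max C (real k) * real ?s powr c'"
      by (intro mult_left_mono) auto
    moreover have "C * log 2 (real (rankM k n f)) powr c'
        \<le> max C (real k) * log 2 (real (rankM k n f)) powr c'"
      by (intro mult_right_mono) auto
    ultimately show ?thesis using C[OF True] by linarith
  next
    case False
    show ?thesis
    proof (cases "?s = 0")
      case True
      \<comment> \<open>The right-hand side is 0 here, so \<open>D k n f\<close> must vanish
        exactly; player 1 is among the summands because \<open>k \<ge> 2\<close>.\<close>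
      have "D_two n {1} ({1..k} - {1}) f = 0" using True assms(1) by simp
      then obtain b where "\<forall>x \<in> {1..k} \<rightarrow>\<^sub>E strings n. f x = b"
        using D_two_eq_0D[of "{1..k}" 1 n f] assms(1) by auto
      then have "D k n f = 0" unfolding D_def by (intro comm_complexity_const) blast
      then show ?thesis by simp
    next
      case False
      \<comment> \<open>A nonzero natural number is at least 1, and so is its power; the factor
        \<open>k\<close> in the constant then covers the bound on \<open>D k n f\<close>.\<close>
      then have "real ?s powr c' \<ge> 1"
        using assms(2) by (intro ge_one_powr_ge_zero) linarith+
      then have "real k * 1 \<le> max C (real k) * real ?s powr c'"
        by (intro mult_mono) auto
      moreover have "real (D k n f) \<le> real k"
        using D_le_if_rankM_le_1[of k n f] \<open>\<not> 2 \<le> rankM k n f\<close> assms(1) by simp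
      ultimately show ?thesis by linarith
    qed
  qed
  then show ?thesis by blast
qed

end
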